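(* Let $(K_n)_{n\ge1}$ be Markov kernels on a finite set $V$ and $\mu_0$ a probability measure; set $\mu_n=\mu_0K_{0,n}$, assumed positive for all $n$. Let $P_i=K_i^*K_i:\ell^2(\mu_i)\to\ell^2(\mu_i)$, with $K_i^*$ the adjoint of $K_i:\ell^2(\mu_i)\to\ell^2(\mu_{i-1})$, let $l(P_i)$ be its logarithmic Sobolev constant, and let $\sigma_1(K_i,\mu_{i-1})$ be the second largest singular value of $K_i:\ell^2(\mu_i)\to\ell^2(\mu_{i-1})$. For $x\in V$ set \[m_x=\min\Bigl\{t\in\mathbb N:\sum_{i=1}^t\log(1+l(P_i))\ge\log\log\bigl(\mu_0(x)^{-1/2}\bigr)\Bigr\}.\] Then for $n\ge m_x$, \[d_2(K_{0,n}(x,\cdot),\mu_n)^2\le e^2\prod_{i=m_x+1}^n\sigma_1(K_i,\mu_{i-1})^2.\]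
   Context: $K_{0,n}=K_1\cdots K_n$. $P_i(x,y)=\frac{1}{\mu_i(x)}\sum_z\mu_{i-1}(z)K_i(z,x)K_i(z,y)$; $\sigma_1(K_i,\mu_{i-1})$ is the square root of the second largest eigenvalue of $P_i$. $\mathcal E_{P,\nu}(f,f)=\frac12\sum_{x,y}|f(x)-f(y)|^2\nu(x)P(x,y)$; $\mathcal L(f^2,\nu)=\sum_xf^2\log(f^2/\|f\|^2_{\ell^2(\nu)})\nu(x)$; $l(P_i)=\inf\{\mathcal E_{P_i,\mu_i}(f,f)/\mathcal L(f^2,\mu_i):\mathcal L(f^2,\mu_i)\ne0,\ f\text{ nonconstant}\}$. $d_2(K_{0,n}(x,\cdot),\mu_n)=(\sum_y|K_{0,n}(x,y)/\mu_n(y)-1|^2\mu_n(y))^{1/2}$. *)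

theory Defs
  imports "HOL-Analysis.Analysis" "HOL-Computational_Algebra.Polynomial" "HOL-Library.Multiset"
begin

type_synonym 'v kernel = "'v \<Rightarrow> 'v \<Rightarrow> real"

definition markov_kernel :: "('v::finite) kernel \<Rightarrow> bool" where
  "markov_kernel K \<longleftrightarrow> (\<forall>x y. K x y \<ge> 0) \<and> (\<forall>x. (\<Sum>y\<in>UNIV. K x y) = 1)"

definition prob_vec :: "('v::finite \<Rightarrow> real) \<Rightarrow> bool" where
  "prob_vec \<mu> \<longleftrightarrow> (\<forall>x. \<mu> x \<ge> 0) \<and> (\<Sum>x\<in>UNIV. \<mu> x) = 1"

fun Kprod :: "(nat \<Rightarrow> ('v::finite) kernel) \<Rightarrow> nat \<Rightarrow> 'v kernel" where
  "Kprod K 0 = (\<lambda>x y. if x = y then 1 else 0)"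
| "Kprod K (Suc n) = (\<lambda>x y. \<Sum>z\<in>UNIV. Kprod K n x z * K (Suc n) z y)"

definition mu :: "(nat \<Rightarrow> ('v::finite) kernel) \<Rightarrow> ('v \<Rightarrow> real) \<Rightarrow> nat \<Rightarrow> 'v \<Rightarrow> real" where
  "mu K \<mu>0 n = (\<lambda>y. \<Sum>x\<in>UNIV. \<mu>0 x * Kprod K n x y)"

definition Pop :: "(nat \<Rightarrow> ('v::finite) kernel) \<Rightarrow> ('v \<Rightarrow> real) \<Rightarrow> nat \<Rightarrow> 'v kernel" where
  "Pop K \<mu>0 i = (\<lambda>x y. (1 / mu K \<mu>0 i x) *
      (\<Sum>z\<in>UNIV. mu K \<mu>0 (i - 1) z * K i z x * K i z y))"

definition dirichlet :: "('v::finite) kernel \<Rightarrow> ('v \<Rightarrow> real) \<Rightarrow> ('v \<Rightarrow> real) \<Rightarrow> real" where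
  "dirichlet P \<nu> f = (1/2) * (\<Sum>x\<in>UNIV. \<Sum>y\<in>UNIV. \<bar>f x - f y\<bar>^2 * \<nu> x * P x y)"

definition entropy_like :: "('v::finite \<Rightarrow> real) \<Rightarrow> ('v \<Rightarrow> real) \<Rightarrow> real" where
  "entropy_like g \<nu> = (\<Sum>x\<in>UNIV. g x * ln (g x / (\<Sum>y\<in>UNIV. g y * \<nu> y)) * \<nu> x)"

definition log_sobolev :: "('v::finite) kernel \<Rightarrow> ('v \<Rightarrow> real) \<Rightarrow> real" where
  "log_sobolev P \<nu> = Inf {dirichlet P \<nu> f / entropy_like (\<lambda>x. (f x)^2) \<nu> | f.
      entropy_like (\<lambda>x. (f x)^2) \<nu> \<noteq> 0 \<and> (\<exists>x y. f x \<noteq> f y)}"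

definition charpoly :: "('v::finite) kernel \<Rightarrow> real poly" where
  "charpoly A = det (\<chi> i j. (if i = j then [:0, 1:] else 0) - [:A i j:])"

definition eig_mset :: "('v::finite) kernel \<Rightarrow> real multiset" where
  "eig_mset A = (\<Sum>a\<in>{a. poly (charpoly A) a = 0}. replicate_mset (order a (charpoly A)) a)"

definition second_eig :: "('v::finite) kernel \<Rightarrow> real" where
  "second_eig A = rev (sorted_list_of_multiset (eig_mset A)) ! 1"

definition sigma1 :: "(nat \<Rightarrow> ('v::finite) kernel) \<Rightarrow> ('v \<Rightarrow> real) \<Rightarrow> nat \<Rightarrow> real" where
  "sigma1 K \<mu>0 i = sqrt (second_eig (Pop K \<mu>0 i))"

definition d2 :: "('v::finite \<Rightarrow> real) \<Rightarrow> ('v \<Rightarrow> real) \<Rightarrow> real" where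
  "d2 h \<nu> = sqrt (\<Sum>y\<in>UNIV. \<bar>h y / \<nu> y - 1\<bar>^2 * \<nu> y)"

end

theory Submission
  imports Defs
begin

text \<open>
  Write \<open>l\<close> for the logarithmic Sobolev constant of \<open>P = K\<^sup>*K\<close>. One step is hypercontractive: it
  maps \<open>\<ell>\<^sup>q(\<mu>\<^sub>i)\<close> to \<open>\<ell>\<^sup>q\<^sup>'(\<mu>\<^sub>i\<^sub>-\<^sub>1)\<close> with \<open>q' = q (1 + l)\<close> and norm at most one, for every \<open>q \<ge> 2\<close>.
  Composing \<open>m\<close> steps from \<open>q = 2\<close> reaches an exponent of at least \<open>- ln \<mu>\<^sub>0(x)\<close> when \<open>m \<ge> m\<^sub>x\<close>, and for such
  an exponent evaluation at \<open>x\<close> costs a factor \<open>e\<close>. By duality the density of \<open>K\<^sub>0\<^sub>,\<^sub>m(x, \<cdot>)\<close> has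
  \<open>\<ell>\<^sup>2\<close> norm at most \<open>e\<close>. Each later step acts on the centred density through \<open>K\<^sup>*\<close>, which contracts
  mean-zero functions by the second singular value.
\<close>

section \<open>Eigenvalues from the characteristic polynomial\<close>

lemma det_const_poly:
  fixes B :: "'v::finite \<Rightarrow> 'v \<Rightarrow> real"
  shows "det (\<chi> i j. [:B i j:]) = [:det (\<chi> i j. B i j):]"
proof -
  have s: "(of_int k :: real poly) = [:of_int k:]" for k
    by (rule of_int_poly)
  have p: "(\<Prod>i\<in>S. [:g i:]) = [:\<Prod>i\<in>S. g i:]" for S and g :: "'v \<Rightarrow> real"
    by (induction S rule: infinite_finite_induct) (auto simp: one_pCons)
  have q: "(\<Sum>i\<in>S. [:g i:]) = [:\<Sum>i\<in>S. g i:]" for S and g :: "('v \<Rightarrow> 'v) \<Rightarrow> real"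
    by (induction S rule: infinite_finite_induct) auto
  show ?thesis
    by (simp add: det_def s p q mult.commute)
qed

lemma poly_charpoly:
  fixes A :: "('v::finite) kernel"
  shows "poly (charpoly A) t = det (\<chi> i j. (if i = j then t else 0) - A i j)"
proof -
  have s: "poly (of_int k :: real poly) t = of_int k" for k
    by (simp add: of_int_poly)
  have i: "poly (if b then [:0, 1:] else 0) t = (if b then t else 0)" for b
    by simp
  show ?thesis
    by (simp add: charpoly_def det_def poly_sum poly_prod s i)
qed

text \<open>Multiply the transpose of \<open>M\<close> on the left by a constant matrix
  \<open>T\<close> with rows \<open>u\<close> and \<open>v\<close> at \<open>i\<close> and
  \<open>j\<close> and unit vectors elsewhere. Rows \<open>i\<close> and \<open>j\<close> of the
  product are then multiples of the two linear factors, which come out of the determinant. The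
  argument covers \<open>a = b\<close>, so multiplicity is detected too.\<close>

lemma charpoly_eigenvectors_dvd:
  fixes A :: "('v::finite) kernel"
  assumes u: "\<And>x. (\<Sum>y\<in>UNIV. A x y * u y) = a * u x"
    and v: "\<And>x. (\<Sum>y\<in>UNIV. A x y * v y) = b * v x"
    and ij: "u i * v j \<noteq> u j * v i"
  shows "[:-a, 1:] * [:-b, 1:] dvd charpoly A"
proof -
  have "i \<noteq> j" using ij by auto
  define T where "T k l = (if k = i then u l else if k = j then v l else if k = l then 1 else 0)" for k l
  define M :: "real poly^'v^'v" where "M = (\<chi> i j. (if i = j then [:0, 1:] else 0) - [:A i j:])"
  define X where "X = (\<chi> k l. [:T k l:]) ** transpose M"
  define U where "U = (\<chi> l. [:u l:])"
  define V where "V = (\<chi> l. [:v l:])"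
  have row: "(\<Sum>y\<in>UNIV. [:w y:] * M $ l $ y) = [:-c, 1:] * [:w l:]"
    if w: "\<And>x. (\<Sum>y\<in>UNIV. A x y * w y) = c * w x" for w c l
  proof -
    have "(\<Sum>y\<in>UNIV. [:w y:] * M $ l $ y)
        = (\<Sum>y\<in>UNIV. (if l = y then [:0, 1:] * [:w y:] else 0)) - (\<Sum>y\<in>UNIV. [:A l y * w y:])"
      unfolding M_def sum_subtractf[symmetric] by (rule sum.cong) (auto simp: algebra_simps)
    also have "(\<Sum>y\<in>UNIV. [:A l y * w y:]) = [:\<Sum>y\<in>UNIV. A l y * w y:]"
    proof -
      have "(\<Sum>y\<in>S. [:g y:]) = [:\<Sum>y\<in>S. g y:]" for S and g :: "'v \<Rightarrow> real"
        by (induction S rule: infinite_finite_induct) auto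
      then show ?thesis .
    qed
    finally show ?thesis by (simp add: w)
  qed
  have Xi: "X $ i = [:-a, 1:] *s U"
    using row[OF u] by (simp add: X_def matrix_matrix_mult_def transpose_def T_def U_def vec_eq_iff)
  have Xj: "X $ j = [:-b, 1:] *s V"
    using row[OF v] \<open>i \<noteq> j\<close>
    by (simp add: X_def matrix_matrix_mult_def transpose_def T_def V_def vec_eq_iff)
  define Y where "Y = (\<chi> k. if k = i then U else X $ k)"
  have X_eq: "X = (\<chi> k. if k = i then [:-a, 1:] *s U else X $ k)"
    using Xi by (simp add: vec_eq_iff)
  have Y_eq: "Y = (\<chi> k. if k = j then [:-b, 1:] *s V else Y $ k)"
    using Xj \<open>i \<noteq> j\<close> by (simp add: vec_eq_iff Y_def)
  have "det X = [:-a, 1:] * det Y"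
    by (subst X_eq) (simp only: det_row_mul Y_def)
  also have "det Y = [:-b, 1:] * det (\<chi> k. if k = j then V else Y $ k)"
    by (subst Y_eq) (simp only: det_row_mul)
  finally have dvdX: "[:-a, 1:] * [:-b, 1:] dvd det X"
    unfolding mult.assoc[symmetric] by (rule dvdI)
  \<comment> \<open>A kernel vector vanishes off \<open>i\<close> and \<open>j\<close>, and there it
    solves a 2 by 2 system with determinant \<open>u i * v j - u j * v i\<close>, nonzero by
    \<open>ij\<close>.\<close>
  have "invertible (\<chi> k l. T k l)"
  proof -
    have "z = 0" if z: "(\<chi> k l. T k l) *v z = 0" for z
    proof -
      have Tz: "(\<Sum>l\<in>UNIV. T k l * z $ l) = 0" for k
        using arg_cong[OF z, of "\<lambda>w. w $ k"] by (simp add: matrix_vector_mult_def)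
      have zk: "z $ k = 0" if "k \<noteq> i" "k \<noteq> j" for k
        using Tz[of k] that by (simp add: T_def of_bool_def if_distrib[of "\<lambda>c. c * _"] cong: if_cong)
      have two: "(\<Sum>l\<in>UNIV. w l * z $ l) = w i * z $ i + w j * z $ j" for w
      proof -
        have "(\<Sum>l\<in>UNIV. w l * z $ l) = (\<Sum>l\<in>{i, j}. w l * z $ l)"
          by (rule sum.mono_neutral_right) (auto simp: zk)
        then show ?thesis using \<open>i \<noteq> j\<close> by simp
      qed
      have ui: "u i * z $ i + u j * z $ j = 0"
        using Tz[of i] two[of u] by (simp add: T_def)
      have vj: "v i * z $ i + v j * z $ j = 0"
        using Tz[of j] two[of v] \<open>i \<noteq> j\<close> by (simp add: T_def)
      have "(u i * v j - u j * v i) * z $ i = 0" "(u i * v j - u j * v i) * z $ j = 0"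
        using ui vj by algebra+
      then have "z $ i = 0" "z $ j = 0" using ij by auto
      with zk show ?thesis by (metis vec_eq_iff zero_index)
    qed
    then show ?thesis
      by (metis invertible_left_inverse matrix_left_invertible_ker)
  qed
  then have T0: "det (\<chi> k l. T k l) \<noteq> 0"
    by (simp add: invertible_det_nz)
  have "det X = smult (det (\<chi> k l. T k l)) (charpoly A)"
    by (simp add: X_def det_mul det_const_poly M_def charpoly_def del: det_transpose)
      (simp only: det_transpose)
  with dvdX show ?thesis
    using T0 by (simp add: dvd_smult_iff)
qed

text \<open>Otherwise only the leading entry of the descending list could reach
  \<open>min a b\<close>, while \<open>a\<close> and \<open>b\<close> are two members, counted with
  multiplicity, that do.\<close>

lemma ge_min_second_largest:
  fixes M :: "real multiset"
  assumes "{#a, b#} \<subseteq># M"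
  shows "min a b \<le> rev (sorted_list_of_multiset M) ! 1"
proof (rule ccontr)
  define xs where "xs = sorted_list_of_multiset M"
  assume "\<not> min a b \<le> rev (sorted_list_of_multiset M) ! 1"
  then have lt: "rev xs ! 1 < min a b" unfolding xs_def by (rule not_le_imp_less)
  have M: "mset (rev xs) = M" and srt: "sorted xs" by (simp_all add: xs_def)
  obtain p q ys where rx: "rev xs = p # q # ys"
  proof -
    have "2 \<le> length (rev xs)"
      using size_mset_mono[OF assms] M by (metis size_add_mset size_empty size_mset numeral_2_eq_2)
    then show ?thesis using that
      by (metis One_nat_def Suc_1 Suc_le_length_iff)
  qed
  have "xs = rev ys @ [q, p]" using rx by (metis append.assoc append_Cons append_Nil rev.simps(2) rev_rev_ident)
  with srt have "\<forall>y\<in>set ys. y \<le> q" by (auto simp: sorted_append)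
  moreover have "q < min a b" using lt rx by simp
  ultimately have "filter_mset (\<lambda>c. c \<ge> min a b) (mset (q # ys)) = {#}"
    by force
  then have "size (filter_mset (\<lambda>c. c \<ge> min a b) M) \<le> 1"
    unfolding M[symmetric] rx by auto
  moreover have "2 \<le> size (filter_mset (\<lambda>c. c \<ge> min a b) M)"
    using size_mset_mono[OF multiset_filter_mono[OF assms, of "\<lambda>c. c \<ge> min a b"]] by simp
  ultimately show False by simp
qed

text \<open>\<open>eig_mset\<close> counts each root with its order, and divisors of a nonzero
  polynomial have smaller orders. A lower bound is the useful direction, since
  \<open>second_eig\<close> later serves as the constant in upper estimates.\<close>

lemma second_eig_ge_min:
  assumes nz: "charpoly A \<noteq> 0"
    and dvd: "[:-a, 1:] * [:-b, 1:] dvd charpoly A"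
  shows "min a b \<le> second_eig A"
proof -
  let ?p = "charpoly A"
  have fin: "finite {a. poly ?p a = 0}" using nz by (rule poly_roots_finite)
  have cnt: "count (eig_mset A) c = order c ?p" for c
  proof -
    have "count (eig_mset A) c = (\<Sum>a\<in>{a. poly ?p a = 0}. if c = a then order a ?p else 0)"
      by (simp add: eig_mset_def count_sum)
    also have "\<dots> = order c ?p"
      using fin nz by (auto simp: order_root)
    finally show ?thesis .
  qed
  have "count {#a, b#} c \<le> order c ?p" for c
  proof -
    have "order c ([:-a, 1:] * [:-b, 1:]) \<le> order c ?p"
      using nz dvd by (rule dvd_imp_order_le)
    moreover have "order c ([:-a, 1:] * [:-b, 1:]) = order c [:-a, 1:] + order c [:-b, 1:]"
      by (rule order_mult) (simp add: no_zero_divisors del: mult_pCons_left mult_pCons_right)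
    moreover have root: "order c [:-e, 1:] \<ge> (if c = e then 1 else 0)" for e
      using order_power_n_n[of e 1] by simp
    ultimately have "(if c = a then 1 else 0) + (if c = b then 1 else 0) \<le> order c ?p"
      using root[of a] root[of b] by linarith
    then show ?thesis by (simp only: count_add_mset count_empty) (auto split: if_splits)
  qed
  then have "{#a, b#} \<subseteq># eig_mset A"
    by (simp add: subseteq_mset_def cnt)
  then show ?thesis
    unfolding second_eig_def by (rule ge_min_second_largest)
qed

section \<open>Weighted inner products and kernels acting on functions\<close>

definition wip :: "('v::finite \<Rightarrow> real) \<Rightarrow> ('v \<Rightarrow> real) \<Rightarrow> ('v \<Rightarrow> real) \<Rightarrow> real" where
  "wip \<mu> f g = (\<Sum>x\<in>UNIV. \<mu> x * f x * g x)"

definition act :: "('v::finite) kernel \<Rightarrow> ('v \<Rightarrow> real) \<Rightarrow> 'v \<Rightarrow> real" where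
  "act K f x = (\<Sum>y\<in>UNIV. K x y * f y)"

lemma wip_commute: "wip \<mu> f g = wip \<mu> g f"
  by (simp add: wip_def mult_ac)

lemma wip_add: "wip \<mu> (\<lambda>x. f x + g x) h = wip \<mu> f h + wip \<mu> g h"
  by (simp add: wip_def algebra_simps sum.distrib)

lemma wip_diff: "wip \<mu> (\<lambda>x. f x - g x) h = wip \<mu> f h - wip \<mu> g h"
  by (simp add: wip_def algebra_simps sum_subtractf)

lemma wip_scale: "wip \<mu> (\<lambda>x. c * f x) h = c * wip \<mu> f h"
  by (simp add: wip_def algebra_simps sum_distrib_left)

lemma wip_scale2: "wip \<mu> (\<lambda>x. c * f x) (\<lambda>x. c * g x) = c\<^sup>2 * wip \<mu> f g"
  by (simp add: wip_def algebra_simps sum_distrib_left power2_eq_square)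

lemma act_add: "act K (\<lambda>x. f x + g x) = (\<lambda>x. act K f x + act K g x)"
  by (simp add: fun_eq_iff act_def algebra_simps sum.distrib)

lemma act_scale: "act K (\<lambda>x. c * f x) = (\<lambda>x. c * act K f x)"
  by (simp add: fun_eq_iff act_def algebra_simps sum_distrib_left)

lemma wip_nonneg: "(\<And>x. \<mu> x \<ge> 0) \<Longrightarrow> wip \<mu> f f \<ge> 0"
  unfolding wip_def mult.assoc by (intro sum_nonneg mult_nonneg_nonneg[OF _ zero_le_square])

lemma wip_self_eq_0:
  assumes "\<And>x. \<mu> x > 0" and "wip \<mu> f f = 0"
  shows "f x = 0"
proof -
  have "\<forall>x\<in>UNIV. \<mu> x * f x * f x = 0"
    using assms(2) unfolding wip_def
    by (subst (asm) sum_nonneg_eq_0_iff) (auto simp: mult.assoc less_imp_le[OF assms(1)])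
  then show ?thesis using assms(1)[of x] by (metis UNIV_I less_irrefl mult_eq_0_iff)
qed

lemma wip_Cauchy_Schwarz:
  assumes "\<And>x. \<mu> x \<ge> 0"
  shows "(wip \<mu> f g)\<^sup>2 \<le> wip \<mu> f f * wip \<mu> g g"
proof -
  have "wip \<mu> f g = (\<Sum>x\<in>UNIV. (sqrt (\<mu> x) * f x) * (sqrt (\<mu> x) * g x))" for f g
    using assms by (simp add: wip_def algebra_simps)
  then show ?thesis
    using Cauchy_Schwarz_ineq_sum[of "\<lambda>x. sqrt (\<mu> x) * f x" "\<lambda>x. sqrt (\<mu> x) * g x" UNIV]
    by (simp add: power2_eq_square)
qed

text \<open>For small \<open>t\<close> of sign opposite to \<open>b\<close> the linear term would
  dominate. This is the first-order condition at an extremum of a quadratic form.\<close>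

lemma psd_null_orthogonal:
  fixes b c :: real
  assumes "\<And>t. 0 \<le> 2 * t * b + t\<^sup>2 * c"
  shows "b = 0"
proof (rule ccontr)
  assume "b \<noteq> 0"
  \<comment> \<open>With \<open>t = -b / d\<close> the expression factors through
    \<open>c - 2 * d\<close>, which is negative because \<open>d\<close> exceeds the modulus of
    \<open>c\<close>.\<close>
  define d where "d = \<bar>c\<bar> + 1"
  have d: "d > 0" by (simp add: d_def add_nonneg_pos)
  have "0 \<le> 2 * (-b / d) * b + (-b / d)\<^sup>2 * c" by (rule assms)
  also have "\<dots> = (b\<^sup>2 / d\<^sup>2) * (c - 2 * d)"
    using d by (simp add: field_simps power2_eq_square)
  also have "\<dots> < 0"
    using \<open>b \<noteq> 0\<close> by (intro mult_pos_neg) (auto simp: d_def)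
  finally show False by simp
qed

lemma ln_ge_one_minus_inverse:
  fixes v :: real
  assumes "v > 0"
  shows "1 - inverse v \<le> ln v"
  using ln_le_minus_one[of "inverse v"] assms by (simp add: ln_inverse)

section \<open>One step of the chain\<close>

text \<open>Here \<open>\<mu>\<close> and \<open>\<nu>\<close> are two consecutive laws of the
  chain.\<close>

locale markov_step =
  fixes K :: "('v::finite) kernel" and \<mu> \<nu> :: "'v \<Rightarrow> real"
  assumes markov: "markov_kernel K"
    and mu_pos: "\<mu> x > 0"
    and mu_sum: "(\<Sum>x\<in>UNIV. \<mu> x) = 1"
    and nu_pos: "\<nu> x > 0"
    and nu_eq: "\<nu> y = (\<Sum>x\<in>UNIV. \<mu> x * K x y)"
begin

definition P :: "'v kernel" where
  "P = (\<lambda>x y. (1 / \<nu> x) * (\<Sum>z\<in>UNIV. \<mu> z * K z x * K z y))"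

text \<open>The adjoint of \<open>act K\<close> between the weighted spaces. It carries densities
  relative to \<open>\<mu>\<close> to densities relative to \<open>\<nu>\<close>.\<close>

definition adj :: "('v \<Rightarrow> real) \<Rightarrow> 'v \<Rightarrow> real" where
  "adj g y = (\<Sum>x\<in>UNIV. \<mu> x * K x y * g x) / \<nu> y"

lemma K_nonneg: "K x y \<ge> 0" and K_sum: "(\<Sum>y\<in>UNIV. K x y) = 1"
  using markov by (auto simp: markov_kernel_def)

lemma mu_nonneg: "\<mu> x \<ge> 0" and nu_nonneg: "\<nu> x \<ge> 0"
  using mu_pos nu_pos by (auto intro: less_imp_le)

lemma nu_sum: "(\<Sum>y\<in>UNIV. \<nu> y) = 1"
proof -
  have "(\<Sum>y\<in>UNIV. \<nu> y) = (\<Sum>x\<in>UNIV. \<Sum>y\<in>UNIV. \<mu> x * K x y)"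
    unfolding nu_eq by (rule sum.swap)
  then show ?thesis by (simp add: sum_distrib_left[symmetric] K_sum mu_sum)
qed

lemma nu_adj: "\<nu> y * adj g y = (\<Sum>x\<in>UNIV. \<mu> x * K x y * g x)"
  using nu_pos[of y] by (simp add: adj_def)

lemma wip_adj: "wip \<nu> (adj g) f = wip \<mu> g (act K f)"
proof -
  have "wip \<nu> (adj g) f = (\<Sum>y\<in>UNIV. \<Sum>x\<in>UNIV. \<mu> x * K x y * g x * f y)"
    by (simp add: wip_def nu_adj sum_distrib_right)
  also have "\<dots> = (\<Sum>x\<in>UNIV. \<Sum>y\<in>UNIV. \<mu> x * K x y * g x * f y)"
    by (rule sum.swap)
  also have "\<dots> = wip \<mu> g (act K f)"
    by (simp add: wip_def act_def sum_distrib_left mult_ac)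
  finally show ?thesis .
qed

lemma act_P: "act P f = adj (act K f)"
proof
  fix x
  have "act P f x = (\<Sum>y\<in>UNIV. \<Sum>z\<in>UNIV. \<mu> z * K z x * K z y * f y) / \<nu> x"
    by (simp add: act_def P_def sum_divide_distrib sum_distrib_right)
  also have "(\<Sum>y\<in>UNIV. \<Sum>z\<in>UNIV. \<mu> z * K z x * K z y * f y)
      = (\<Sum>z\<in>UNIV. \<Sum>y\<in>UNIV. \<mu> z * K z x * K z y * f y)"
    by (rule sum.swap)
  finally show "act P f x = adj (act K f) x"
    by (simp add: adj_def act_def sum_distrib_left mult_ac)
qed

lemma act_K_one: "act K (\<lambda>_. 1) = (\<lambda>_. 1)"
  by (simp add: fun_eq_iff act_def K_sum)

lemma act_P_one: "act P (\<lambda>_. 1) = (\<lambda>_. 1)"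
  using nu_pos by (auto simp: act_P act_K_one adj_def nu_eq[symmetric] less_imp_neq[THEN not_sym])

text \<open>Write the form as a sum over the intermediate state \<open>z\<close> and expand the
  square; the rows of \<open>K\<close> sum to one and \<open>\<nu>\<close> is the image of
  \<open>\<mu>\<close>. The energy is thus the loss of squared norm under \<open>K\<close>, which
  makes \<open>K\<close> a contraction and brings in the logarithmic Sobolev constant.\<close>

lemma dirichlet_P: "dirichlet P \<nu> f = wip \<nu> f f - wip \<mu> (act K f) (act K f)"
proof -
  have "(\<Sum>x\<in>UNIV. \<Sum>y\<in>UNIV. \<bar>f x - f y\<bar>^2 * \<nu> x * P x y)
      = (\<Sum>x\<in>UNIV. \<Sum>y\<in>UNIV. \<Sum>z\<in>UNIV. (f x - f y)\<^sup>2 * \<mu> z * K z x * K z y)"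
  proof (intro sum.cong refl)
    fix x y
    have "\<bar>f x - f y\<bar>^2 * \<nu> x * P x y = (f x - f y)\<^sup>2 * (\<Sum>z\<in>UNIV. \<mu> z * K z x * K z y)"
      using nu_pos[of x] by (simp add: P_def)
    then show "\<bar>f x - f y\<bar>^2 * \<nu> x * P x y = (\<Sum>z\<in>UNIV. (f x - f y)\<^sup>2 * \<mu> z * K z x * K z y)"
      by (simp add: sum_distrib_left mult_ac)
  qed
  also have "\<dots> = (\<Sum>x\<in>UNIV. \<Sum>z\<in>UNIV. \<Sum>y\<in>UNIV. (f x - f y)\<^sup>2 * \<mu> z * K z x * K z y)"
    by (rule sum.cong[OF refl], rule sum.swap)
  also have "\<dots> = (\<Sum>z\<in>UNIV. \<Sum>x\<in>UNIV. \<Sum>y\<in>UNIV. (f x - f y)\<^sup>2 * \<mu> z * K z x * K z y)"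
    by (rule sum.swap)
  \<comment> \<open>For fixed \<open>z\<close> the double sum is \<open>\<mu> z\<close> times twice
    the variance of \<open>f\<close> under the law \<open>K z\<close>.\<close>
  also have "\<dots> = (\<Sum>z\<in>UNIV. \<mu> z * (2 * act K (\<lambda>x. (f x)\<^sup>2) z - 2 * (act K f z)\<^sup>2))"
  proof (intro sum.cong refl)
    fix z
    have "(\<Sum>x\<in>UNIV. \<Sum>y\<in>UNIV. (f x - f y)\<^sup>2 * \<mu> z * K z x * K z y)
        = (\<Sum>x\<in>UNIV. \<Sum>y\<in>UNIV. \<mu> z * ((K z x * (f x)\<^sup>2) * K z y + K z x * (K z y * (f y)\<^sup>2)
            - 2 * ((K z x * f x) * (K z y * f y))))"
      by (intro sum.cong refl) (simp add: algebra_simps power2_eq_square)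
    also have "\<dots> = \<mu> z * ((\<Sum>x\<in>UNIV. K z x * (f x)\<^sup>2) * (\<Sum>y\<in>UNIV. K z y)
            + (\<Sum>x\<in>UNIV. K z x) * (\<Sum>y\<in>UNIV. K z y * (f y)\<^sup>2)
            - 2 * ((\<Sum>x\<in>UNIV. K z x * f x) * (\<Sum>y\<in>UNIV. K z y * f y)))"
      by (simp only: sum_product sum.distrib sum_subtractf sum_distrib_left[symmetric])
    finally have "(\<Sum>x\<in>UNIV. \<Sum>y\<in>UNIV. (f x - f y)\<^sup>2 * \<mu> z * K z x * K z y) = \<dots>" .
    then show "(\<Sum>x\<in>UNIV. \<Sum>y\<in>UNIV. (f x - f y)\<^sup>2 * \<mu> z * K z x * K z y)
        = \<mu> z * (2 * act K (\<lambda>x. (f x)\<^sup>2) z - 2 * (act K f z)\<^sup>2)"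
      by (simp add: act_def K_sum power2_eq_square)
  qed
  also have "\<dots> = 2 * (wip \<mu> (\<lambda>_. 1) (act K (\<lambda>x. (f x)\<^sup>2)) - wip \<mu> (act K f) (act K f))"
    by (simp add: wip_def sum_distrib_left sum_subtractf[symmetric] power2_eq_square algebra_simps)
  also have "wip \<mu> (\<lambda>_. 1) (act K (\<lambda>x. (f x)\<^sup>2)) = wip \<nu> f f"
    by (simp add: wip_def[of \<nu>] wip_adj[symmetric] adj_def nu_eq[symmetric] power2_eq_square)
      (simp add: wip_def mult_ac nu_pos[THEN less_imp_neq, THEN not_sym])
  finally show ?thesis by (simp add: dirichlet_def)
qed

lemma dirichlet_P_nonneg: "dirichlet P \<nu> f \<ge> 0"
proof -
  have "P x y \<ge> 0" for x y
    unfolding P_def by (intro mult_nonneg_nonneg sum_nonneg) (auto simp: mu_nonneg nu_nonneg K_nonneg)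
  then show ?thesis
    unfolding dirichlet_def by (intro mult_nonneg_nonneg sum_nonneg) (auto simp: nu_nonneg)
qed

text \<open>\<open>P\<close> is a contraction, so 2 is not an eigenvalue and the polynomial does not
  vanish there.\<close>

lemma charpoly_P_nonzero: "charpoly P \<noteq> 0"
proof -
  have "z = 0" if z: "(\<chi> i j. (if i = j then 2 else 0) - P i j) *v z = 0" for z
  proof -
    have e: "act P (($) z) i = 2 * z $ i" for i
    proof -
      have "0 = (\<Sum>j\<in>UNIV. (if i = j then 2 * z $ j else 0) - P i j * z $ j)"
        using arg_cong[OF z, of "\<lambda>w. w $ i"]
        by (simp add: matrix_vector_mult_def left_diff_distrib if_distrib[of "\<lambda>c. c * _"] cong: if_cong)
      then show ?thesis by (simp add: act_def sum_subtractf)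
    qed
    have "2 * wip \<nu> (($) z) (($) z) = wip \<nu> (act P (($) z)) (($) z)"
      by (simp add: e wip_def sum_distrib_left mult_ac)
    also have "\<dots> = wip \<mu> (act K (($) z)) (act K (($) z))"
      by (simp add: act_P wip_adj)
    also have "\<dots> \<le> wip \<nu> (($) z) (($) z)"
      using dirichlet_P_nonneg[of "($) z"] by (simp add: dirichlet_P)
    finally have "wip \<nu> (($) z) (($) z) = 0"
      using wip_nonneg[of \<nu> "($) z"] nu_nonneg by fastforce
    then show ?thesis using wip_self_eq_0[of \<nu> "($) z", OF nu_pos] by (simp add: vec_eq_iff)
  qed
  then have "invertible (\<chi> i j. (if i = j then 2 else 0) - P i j)"
    unfolding invertible_left_inverse matrix_left_invertible_ker by blast
  then have "poly (charpoly P) 2 \<noteq> 0"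
    by (simp add: invertible_det_nz poly_charpoly)
  then show ?thesis by auto
qed

subsection \<open>The second eigenvalue\<close>

text \<open>The squared norm of \<open>act K\<close> attains its maximum \<open>r\<close> on the
  compact unit sphere of mean-zero functions, and the first-order condition makes the maximizer an
  eigenvector of \<open>P\<close>. Two distinct points make the sphere nonempty.\<close>

lemma Rayleigh_maximizer:
  assumes ij: "i \<noteq> (j :: 'v)"
  obtains \<phi> r k where "wip \<nu> \<phi> (\<lambda>_. 1) = 0" "\<phi> k \<noteq> 0" "\<And>x. act P \<phi> x = r * \<phi> x"
    "0 \<le> r" "r \<le> 1"
    "\<And>\<psi>. wip \<nu> \<psi> (\<lambda>_. 1) = 0 \<Longrightarrow> wip \<mu> (act K \<psi>) (act K \<psi>) \<le> r * wip \<nu> \<psi> \<psi>"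
proof -
  define S where "S = {z::real^'v. wip \<nu> (($) z) (($) z) = 1 \<and> wip \<nu> (($) z) (\<lambda>_. 1) = 0}"
  define Q where "Q z = wip \<mu> (act K (($) z)) (act K (($) z))" for z :: "real^'v"
  have unit: "\<exists>z\<in>S. \<forall>x. \<psi> x = sqrt (wip \<nu> \<psi> \<psi>) * z $ x"
    if "wip \<nu> \<psi> (\<lambda>_. 1) = 0" "wip \<nu> \<psi> \<psi> \<noteq> 0" for \<psi>
  proof -
    define c where "c = sqrt (wip \<nu> \<psi> \<psi>)"
    have c: "c * c = wip \<nu> \<psi> \<psi>" "c \<noteq> 0"
      using that wip_nonneg[of \<nu> \<psi>] nu_nonneg by (auto simp: c_def)
    define z where "z = (\<chi> x. (1 / c) * \<psi> x)"
    have z: "($) z = (\<lambda>x. (1 / c) * \<psi> x)" by (simp add: z_def fun_eq_iff)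
    have "wip \<nu> (($) z) (($) z) = (1 / c)\<^sup>2 * wip \<nu> \<psi> \<psi>"
      unfolding z by (rule wip_scale2)
    moreover have "wip \<nu> (($) z) (\<lambda>_. 1) = 0"
      using that unfolding z wip_scale by simp
    ultimately have "z \<in> S" using c that(2) by (simp add: S_def field_simps power2_eq_square)
    moreover have "\<psi> x = c * z $ x" for x
      using c by (simp add: z_def)
    ultimately show ?thesis unfolding c_def by blast
  qed
  have "compact S"
  proof -
    have "closed S"
      unfolding S_def wip_def by (intro closed_Collect_conj closed_Collect_eq continuous_intros)
    moreover have "bounded S"
    proof -
      define d where "d = (\<Sum>i\<in>UNIV. 1 / sqrt (\<nu> i))"
      have "norm z \<le> d" if "z \<in> S" for z
      proof -
        have "\<bar>z $ i\<bar> \<le> 1 / sqrt (\<nu> i)" for i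
        proof -
          have "\<nu> i * (z $ i)\<^sup>2 \<le> (\<Sum>x\<in>UNIV. \<nu> x * (z $ x)\<^sup>2)"
            by (rule member_le_sum) (auto simp: nu_nonneg)
          also have "\<dots> = 1" using that by (simp add: S_def wip_def power2_eq_square mult.assoc)
          finally have "sqrt (\<nu> i * (z $ i)\<^sup>2) \<le> 1" by simp
          then show ?thesis using nu_pos[of i] by (simp add: real_sqrt_mult field_simps)
        qed
        then have "(\<Sum>i\<in>UNIV. \<bar>z $ i\<bar>) \<le> d" unfolding d_def by (rule sum_mono)
        with norm_le_l1_cart[of z] show ?thesis by linarith
      qed
      then show ?thesis by (auto simp: bounded_iff)
    qed
    ultimately show ?thesis by (simp add: compact_eq_bounded_closed)
  qed
  moreover have "S \<noteq> {}"
  proof -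
    define \<psi> where "\<psi> x = (if x = i then \<nu> j else if x = j then - \<nu> i else 0)" for x
    have "wip \<nu> \<psi> (\<lambda>_. 1) = (\<Sum>x\<in>{i, j}. \<nu> x * \<psi> x)"
      unfolding wip_def by (rule sum.mono_neutral_cong_right) (auto simp: \<psi>_def)
    then have "wip \<nu> \<psi> (\<lambda>_. 1) = 0" using ij by (simp add: \<psi>_def)
    moreover have "wip \<nu> \<psi> \<psi> \<noteq> 0"
      using wip_self_eq_0[of \<nu> \<psi> i, OF nu_pos] nu_pos[of j] by (auto simp: \<psi>_def)
    ultimately show ?thesis using unit by blast
  qed
  moreover have "continuous_on S Q"
    unfolding Q_def wip_def act_def by (intro continuous_intros)
  ultimately obtain z where z: "z \<in> S" and zmax: "\<And>w. w \<in> S \<Longrightarrow> Q w \<le> Q z"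
    using continuous_attains_sup by metis
  define \<phi> where "\<phi> = ($) z"
  define r where "r = Q z"
  have phi: "wip \<nu> \<phi> \<phi> = 1" "wip \<nu> \<phi> (\<lambda>_. 1) = 0" using z by (auto simp: S_def \<phi>_def)
  have lam: "wip \<mu> (act K \<phi>) (act K \<phi>) = r" by (simp add: r_def Q_def \<phi>_def)
  have max: "wip \<mu> (act K \<psi>) (act K \<psi>) \<le> r * wip \<nu> \<psi> \<psi>" if psi: "wip \<nu> \<psi> (\<lambda>_. 1) = 0" for \<psi>
  proof (cases "wip \<nu> \<psi> \<psi> = 0")
    case True
    then have "\<psi> = (\<lambda>_. 0)" using wip_self_eq_0[of \<nu> \<psi>, OF nu_pos] by blast
    then show ?thesis by (simp add: act_def wip_def)
  next
    case False
    define c where "c = sqrt (wip \<nu> \<psi> \<psi>)"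
    obtain w where w: "w \<in> S" "\<And>x. \<psi> x = c * w $ x"
      using unit[OF psi False] unfolding c_def by blast
    have "act K \<psi> = (\<lambda>x. c * act K (($) w) x)"
      unfolding act_scale[symmetric] using w(2) by presburger
    then have "wip \<mu> (act K \<psi>) (act K \<psi>) = c\<^sup>2 * Q w"
      by (simp only: Q_def wip_scale2)
    also have "\<dots> = wip \<nu> \<psi> \<psi> * Q w"
      using wip_nonneg[of \<nu> \<psi>] nu_nonneg by (simp add: c_def)
    also have "\<dots> \<le> wip \<nu> \<psi> \<psi> * r"
      unfolding r_def using zmax[OF w(1)] wip_nonneg[of \<nu> \<psi>] nu_nonneg by (intro mult_left_mono) auto
    finally show ?thesis by (simp add: mult.commute)
  qed
  \<comment> \<open>By \<open>max\<close> the form given by \<open>r\<close> times the squared norm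
    minus the squared norm of the image is nonnegative on mean-zero functions. It vanishes at
    \<open>\<phi>\<close>, so its polar form with \<open>\<phi>\<close> vanishes as well.\<close>
  have orth: "wip \<mu> (act K \<phi>) (act K \<psi>) = r * wip \<nu> \<phi> \<psi>" if psi: "wip \<nu> \<psi> (\<lambda>_. 1) = 0" for \<psi>
  proof -
    have "r * wip \<nu> \<phi> \<psi> - wip \<mu> (act K \<phi>) (act K \<psi>) = 0"
    proof (rule psd_null_orthogonal)
      fix t
      have expand: "wip \<rho> (\<lambda>x. f x + t * g x) (\<lambda>x. f x + t * g x)
          = wip \<rho> f f + 2 * t * wip \<rho> f g + t\<^sup>2 * wip \<rho> g g" for \<rho> f g
        by (simp add: wip_def sum_distrib_left sum.distrib[symmetric] power2_eq_square algebra_simps)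
      have "wip \<nu> (\<lambda>x. \<phi> x + t * \<psi> x) (\<lambda>_. 1) = 0"
        using phi psi by (simp only: wip_add wip_scale)
      from max[OF this] show "0 \<le> 2 * t * (r * wip \<nu> \<phi> \<psi> - wip \<mu> (act K \<phi>) (act K \<psi>))
          + t\<^sup>2 * (r * wip \<nu> \<psi> \<psi> - wip \<mu> (act K \<psi>) (act K \<psi>))"
        by (simp add: act_add act_scale expand phi lam algebra_simps)
    qed
    then show ?thesis by simp
  qed
  have eig: "act P \<phi> x = r * \<phi> x" for x
  proof -
    \<comment> \<open>The residual has mean zero itself, so \<open>orth\<close> may be tested
      against it and gives norm zero.\<close>
    define w where "w x = act P \<phi> x - r * \<phi> x" for x
    have wip_w: "wip \<nu> w f = wip \<mu> (act K \<phi>) (act K f) - r * wip \<nu> \<phi> f" for f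
      unfolding w_def wip_diff wip_scale act_P wip_adj ..
    have "wip \<mu> (act K \<phi>) (\<lambda>_. 1) = wip \<nu> \<phi> (\<lambda>_. 1)"
      using wip_adj[of "\<lambda>_. 1" \<phi>] act_P_one act_P[of "\<lambda>_. 1"]
      by (simp add: act_K_one wip_commute)
    then have "wip \<nu> w (\<lambda>_. 1) = 0" using phi by (simp add: wip_w act_K_one)
    then have "wip \<nu> w w = 0" using orth by (simp add: wip_w)
    then have "w x = 0" using wip_self_eq_0[of \<nu> w, OF nu_pos] by blast
    then show ?thesis by (simp add: w_def)
  qed
  have "\<exists>k. \<phi> k \<noteq> 0"
    by (rule ccontr) (use phi(1) in \<open>simp add: wip_def\<close>)
  then obtain k where "\<phi> k \<noteq> 0" ..
  moreover have "0 \<le> r" using wip_nonneg[of \<mu> "act K \<phi>"] lam mu_nonneg by simp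
  moreover have "r \<le> 1" using dirichlet_P_nonneg[of \<phi>] lam phi by (simp add: dirichlet_P)
  ultimately show thesis using that phi(2) eig max by blast
qed

text \<open>The constant function has eigenvalue 1 and the mean-zero maximizer has eigenvalue
  \<open>r\<close>, at most 1. They are independent, so \<open>second_eig_ge_min\<close> puts
  \<open>second_eig P\<close> above \<open>r\<close>.\<close>

lemma second_eig_P:
  assumes ij: "i \<noteq> (j :: 'v)"
  shows "0 \<le> second_eig P"
    and "wip \<nu> \<psi> (\<lambda>_. 1) = 0 \<Longrightarrow> wip \<mu> (act K \<psi>) (act K \<psi>) \<le> second_eig P * wip \<nu> \<psi> \<psi>"
proof -
  obtain \<phi> r k where phi: "wip \<nu> \<phi> (\<lambda>_. 1) = 0" "\<phi> k \<noteq> 0" "\<And>x. act P \<phi> x = r * \<phi> x"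
    "0 \<le> r" "r \<le> 1"
    "\<And>\<psi>. wip \<nu> \<psi> (\<lambda>_. 1) = 0 \<Longrightarrow> wip \<mu> (act K \<psi>) (act K \<psi>) \<le> r * wip \<nu> \<psi> \<psi>"
    using Rayleigh_maximizer[OF ij] by metis
  have "\<exists>l. \<phi> l \<noteq> \<phi> k"
  proof (rule ccontr)
    assume "\<nexists>l. \<phi> l \<noteq> \<phi> k"
    then have "wip \<nu> \<phi> (\<lambda>_. 1) = (\<Sum>x\<in>UNIV. \<nu> x * \<phi> k)"
      unfolding wip_def by (intro sum.cong) auto
    then have "wip \<nu> \<phi> (\<lambda>_. 1) = \<phi> k"
      by (simp add: sum_distrib_right[symmetric] nu_sum)
    with phi show False by simp
  qed
  then obtain l where l: "\<phi> l \<noteq> \<phi> k" ..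
  have "[:-1, 1:] * [:-r, 1:] dvd charpoly P"
    using charpoly_eigenvectors_dvd[of P "\<lambda>_. 1" 1 \<phi> r l k] act_P_one phi(3) l
    by (simp add: act_def fun_eq_iff)
  then have "r \<le> second_eig P"
    using second_eig_ge_min[OF charpoly_P_nonzero] phi(5) by fastforce
  then show "0 \<le> second_eig P"
    and "wip \<nu> \<psi> (\<lambda>_. 1) = 0 \<Longrightarrow> wip \<mu> (act K \<psi>) (act K \<psi>) \<le> second_eig P * wip \<nu> \<psi> \<psi>"
    using phi(4) phi(6)[of \<psi>] wip_nonneg[of \<nu> \<psi>] nu_nonneg
    by (auto intro: order.trans mult_right_mono)
qed

text \<open>The squared norm of \<open>adj g\<close> is the pairing of \<open>g\<close> with
  \<open>act K (adj g)\<close>. Cauchy-Schwarz and the bound for the mean-zero function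
  \<open>adj g\<close> leave a common factor to cancel.\<close>

lemma adj_contraction:
  assumes ij: "i \<noteq> (j :: 'v)" and g: "wip \<mu> g (\<lambda>_. 1) = 0"
  shows "wip \<nu> (adj g) (adj g) \<le> second_eig P * wip \<mu> g g"
proof -
  define a where "a = wip \<nu> (adj g) (adj g)"
  have a0: "a \<ge> 0" unfolding a_def by (rule wip_nonneg) (rule nu_nonneg)
  have g0: "wip \<mu> g g \<ge> 0" by (rule wip_nonneg) (rule mu_nonneg)
  have orth: "wip \<nu> (adj g) (\<lambda>_. 1) = 0" using g by (simp add: wip_adj act_K_one)
  have "a\<^sup>2 = (wip \<mu> g (act K (adj g)))\<^sup>2" by (simp add: a_def wip_adj)
  also have "\<dots> \<le> wip \<mu> g g * wip \<mu> (act K (adj g)) (act K (adj g))"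
    by (rule wip_Cauchy_Schwarz) (rule mu_nonneg)
  also have "\<dots> \<le> wip \<mu> g g * (second_eig P * a)"
    unfolding a_def by (intro mult_left_mono second_eig_P(2)[OF ij orth] g0)
  finally have "a * a \<le> a * (second_eig P * wip \<mu> g g)"
    by (simp add: power2_eq_square mult_ac)
  then have "a = 0 \<or> a \<le> second_eig P * wip \<mu> g g"
    using a0 by (auto simp: mult_le_cancel_left)
  then show ?thesis
    using second_eig_P(1)[OF ij] g0 by (auto simp: a_def[symmetric])
qed

subsection \<open>Hypercontractivity\<close>

lemma act_K_pos:
  assumes "\<And>y. f y > 0"
  shows "act K f x > 0"
proof -
  have "\<exists>y. K x y \<noteq> 0"
    using K_sum[of x] by (metis sum.neutral zero_neq_one)
  then obtain y where "K x y > 0" using K_nonneg[of x] by (metis less_eq_real_def)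
  then have "0 < K x y * f y" using assms by simp
  also have "\<dots> \<le> act K f x"
    unfolding act_def using K_nonneg assms
    by (intro member_le_sum) (auto intro: mult_nonneg_nonneg[OF _ less_imp_le])
  finally show ?thesis .
qed

text \<open>Pointwise \<open>g x * ln (g x / m)\<close> is at least \<open>g x - m\<close>, which
  has mean zero.\<close>

lemma entropy_nonneg:
  assumes g: "\<And>x. g x \<ge> 0"
  shows "entropy_like g \<nu> \<ge> 0"
proof -
  define m where "m = (\<Sum>y\<in>UNIV. g y * \<nu> y)"
  have m0: "m \<ge> 0" unfolding m_def using g nu_nonneg by (intro sum_nonneg mult_nonneg_nonneg)
  have "(g x - m) * \<nu> x \<le> g x * ln (g x / m) * \<nu> x" for x
  proof (rule mult_right_mono[OF _ nu_nonneg])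
    show "g x - m \<le> g x * ln (g x / m)"
    proof (cases "g x = 0 \<or> m = 0")
      \<comment> \<open>If \<open>m = 0\<close>, positivity of \<open>\<nu>\<close> forces
        \<open>g x = 0\<close>, so the factor \<open>g x\<close> kills the logarithm whatever its
        value at the degenerate quotient.\<close>
      case True
      have "g x = 0" if "m = 0"
      proof -
        have "g x * \<nu> x \<le> m"
          unfolding m_def using g nu_nonneg by (intro member_le_sum mult_nonneg_nonneg) auto
        with that show ?thesis using g[of x] nu_pos[of x] by (simp add: mult_le_0_iff)
      qed
      with True m0 show ?thesis by auto
    next
      case False
      then have pos: "g x > 0" "m > 0" using g[of x] m0 by auto
      have "1 - inverse (g x / m) \<le> ln (g x / m)"
        using pos by (intro ln_ge_one_minus_inverse) simp
      then have "g x * (1 - inverse (g x / m)) \<le> g x * ln (g x / m)"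
        using pos by (intro mult_left_mono) auto
      then show ?thesis using pos by (simp add: right_diff_distrib)
    qed
  qed
  then have "(\<Sum>x\<in>UNIV. (g x - m) * \<nu> x) \<le> entropy_like g \<nu>"
    unfolding entropy_like_def m_def by (intro sum_mono) blast
  moreover have "(\<Sum>x\<in>UNIV. (g x - m) * \<nu> x) = 0"
    by (simp add: left_diff_distrib sum_subtractf sum_distrib_left[symmetric] nu_sum m_def)
  ultimately show ?thesis by simp
qed

lemma log_sobolev_P:
  assumes ij: "i \<noteq> (j :: 'v)"
  shows "0 \<le> log_sobolev P \<nu>"
    and "log_sobolev P \<nu> * entropy_like (\<lambda>x. (f x)\<^sup>2) \<nu> \<le> dirichlet P \<nu> f"
proof -
  define S where "S = {dirichlet P \<nu> f / entropy_like (\<lambda>x. (f x)^2) \<nu> | f.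
      entropy_like (\<lambda>x. (f x)^2) \<nu> \<noteq> 0 \<and> (\<exists>x y. f x \<noteq> f y)}"
  have ls: "log_sobolev P \<nu> = Inf S" by (simp add: log_sobolev_def S_def)
  have ent: "entropy_like (\<lambda>x. (f x)\<^sup>2) \<nu> \<ge> 0" for f
    by (rule entropy_nonneg) simp
  have lower: "0 \<le> s" if "s \<in> S" for s
    using that ent dirichlet_P_nonneg by (auto simp: S_def)
  have "S \<noteq> {}"
  proof -
    \<comment> \<open>The indicator of a point of mass below 1 has positive entropy, so the infimum
      is over a nonempty set.\<close>
    define e where "e x = (if x = i then 1 else 0 :: real)" for x
    have e2: "(e x)\<^sup>2 = (if x = i then 1 else 0)" for x by (simp add: e_def)
    have "entropy_like (\<lambda>x. (e x)\<^sup>2) \<nu> = ln (1 / \<nu> i) * \<nu> i"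
      by (simp add: entropy_like_def e2 if_distrib[of "\<lambda>c. c * _"] cong: if_cong)
    moreover have "\<nu> i < 1"
    proof -
      have "\<nu> i + \<nu> j = (\<Sum>x\<in>{i, j}. \<nu> x)" using ij by simp
      also have "\<dots> \<le> (\<Sum>x\<in>UNIV. \<nu> x)" by (rule sum_mono2) (auto simp: nu_nonneg)
      finally show ?thesis using nu_pos[of j] by (simp add: nu_sum)
    qed
    ultimately have "entropy_like (\<lambda>x. (e x)\<^sup>2) \<nu> \<noteq> 0"
      using nu_pos[of i] by (simp add: ln_div)
    moreover have "e i \<noteq> e j" using ij by (simp add: e_def)
    ultimately show ?thesis unfolding S_def by blast
  qed
  then show "0 \<le> log_sobolev P \<nu>" unfolding ls by (intro cInf_greatest lower)
  show "log_sobolev P \<nu> * entropy_like (\<lambda>x. (f x)\<^sup>2) \<nu> \<le> dirichlet P \<nu> f"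
  proof (cases "entropy_like (\<lambda>x. (f x)\<^sup>2) \<nu> = 0")
    case True
    then show ?thesis using dirichlet_P_nonneg by simp
  next
    case False
    have "\<exists>x y. f x \<noteq> f y"
    proof (rule ccontr)
      assume "\<nexists>x y. f x \<noteq> f y"
      then have "(\<lambda>x. (f x)\<^sup>2) = (\<lambda>_. (f i)\<^sup>2)" by (intro ext arg_cong[where f = "\<lambda>c. c\<^sup>2"]) blast
      with False have "entropy_like (\<lambda>_. (f i)\<^sup>2) \<nu> \<noteq> 0" by (simp only:) simp
      then show False
        by (simp add: entropy_like_def sum_distrib_left[symmetric] nu_sum split: if_splits)
    qed
    with False have "dirichlet P \<nu> f / entropy_like (\<lambda>x. (f x)^2) \<nu> \<in> S"
      unfolding S_def by blast
    then have "log_sobolev P \<nu> \<le> dirichlet P \<nu> f / entropy_like (\<lambda>x. (f x)^2) \<nu>"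
      unfolding ls by (rule cInf_lower) (auto intro: bdd_belowI lower)
    moreover have "entropy_like (\<lambda>x. (f x)\<^sup>2) \<nu> > 0" using False ent[of f] by simp
    ultimately show ?thesis by (simp add: field_simps)
  qed
qed

text \<open>
  With \<open>Z\<close> the left-hand side, the weights
  \<open>R x y = \<mu> x * K x y * f y * h x powr (q * r - 1) / Z\<close> form the coupling at which the
  variational formula for \<open>ln Z\<close> is attained. Its first marginal has density \<open>a\<^sup>2\<close> relative
  to \<open>\<mu>\<close> and its second one density \<open>\<zeta>\<close> relative to \<open>\<nu>\<close>; the logarithmic Sobolev
  inequality is applied to \<open>sqrt \<zeta>\<close>, and the remaining estimates are instances of
  \<open>ln v \<ge> 1 - 1 / v\<close>.
\<close>
lemma hypercontractivity:
  fixes f :: "'v \<Rightarrow> real" and q :: real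
  defines "r \<equiv> 1 + log_sobolev P \<nu>"
  assumes ij: "i \<noteq> (j :: 'v)"
    and q: "q \<ge> 2"
    and f: "\<And>y. f y > 0"
    and norm: "(\<Sum>y\<in>UNIV. \<nu> y * f y powr q) \<le> 1"
  shows "(\<Sum>x\<in>UNIV. \<mu> x * act K f x powr (q * r)) \<le> 1"
proof -
  define h where "h = act K f"
  have h: "h x > 0" for x unfolding h_def using f by (rule act_K_pos)
  define Z where "Z = (\<Sum>x\<in>UNIV. \<mu> x * h x powr (q * r))"
  have Z: "Z > 0" unfolding Z_def using h mu_pos by (intro sum_pos) (auto simp: less_imp_neq[THEN not_sym])
  define R where "R x y = \<mu> x * K x y * f y * h x powr (q * r - 1) / Z" for x y
  have R0: "R x y \<ge> 0" for x y
    unfolding R_def using Z f[of y] mu_nonneg K_nonneg by (simp add: less_imp_le)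
  define a where "a x = h x powr (q * r / 2) / sqrt Z" for x
  have aa: "a x * a x = h x powr (q * r) / Z" for x
    using Z by (simp add: a_def powr_add[symmetric])
  have row: "(\<Sum>y\<in>UNIV. R x y) = \<mu> x * (a x * a x)" for x
  proof -
    have "(\<Sum>y\<in>UNIV. R x y) = (\<Sum>y\<in>UNIV. K x y * f y) * (\<mu> x * h x powr (q * r - 1) / Z)"
      unfolding R_def sum_distrib_right by (intro sum.cong) (auto simp: field_simps)
    also have "(\<Sum>y\<in>UNIV. K x y * f y) = h x powr 1" using h[of x] by (simp add: h_def act_def)
    also have "h x powr 1 * (\<mu> x * h x powr (q * r - 1) / Z)
        = \<mu> x * (h x powr 1 * h x powr (q * r - 1)) / Z" by simp
    also have "h x powr 1 * h x powr (q * r - 1) = h x powr (q * r)"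
      by (simp only: powr_add[symmetric]) simp
    finally show ?thesis by (simp add: aa)
  qed
  have wip_a: "wip \<mu> a a = 1"
    using Z by (simp add: wip_def aa mult.assoc Z_def sum_divide_distrib[symmetric])
  define \<zeta> where "\<zeta> y = (\<Sum>x\<in>UNIV. R x y) / \<nu> y" for y
  have col: "(\<Sum>x\<in>UNIV. R x y) = \<nu> y * \<zeta> y" for y
    using nu_pos[of y] by (simp add: \<zeta>_def)
  have zeta: "\<zeta> y > 0" for y
  proof -
    have "\<exists>x. \<mu> x * K x y \<noteq> 0"
      using nu_eq[of y] nu_pos[of y] sum.not_neutral_contains_not_neutral[of "\<lambda>x. \<mu> x * K x y" UNIV] by auto
    then obtain x where "K x y \<noteq> 0" by auto
    then have "K x y > 0" using K_nonneg[of x y] by simp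
    then have "0 < R x y" unfolding R_def using Z f[of y] mu_pos[of x] h[of x] by simp
    also have "\<dots> \<le> (\<Sum>x\<in>UNIV. R x y)" by (rule member_le_sum) (auto simp: R0)
    finally show ?thesis unfolding \<zeta>_def using nu_pos[of y] by simp
  qed
  have R1: "(\<Sum>x\<in>UNIV. \<Sum>y\<in>UNIV. R x y) = 1"
    using wip_a by (simp add: row wip_def mult.assoc)
  have zeta1: "(\<Sum>y\<in>UNIV. \<nu> y * \<zeta> y) = 1"
    unfolding col[symmetric] using R1 by (subst sum.swap)
  define S1 where "S1 = (\<Sum>x\<in>UNIV. \<Sum>y\<in>UNIV. R x y * ln (f y))"
  define S2 where "S2 = (\<Sum>x\<in>UNIV. \<Sum>y\<in>UNIV. R x y * ln (h x))"
  define S3 where "S3 = (\<Sum>x\<in>UNIV. \<Sum>y\<in>UNIV. R x y * ln (\<zeta> y))"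
  have snd_marginal: "(\<Sum>x\<in>UNIV. \<Sum>y\<in>UNIV. R x y * F y) = (\<Sum>y\<in>UNIV. \<nu> y * \<zeta> y * F y)" for F
    by (subst sum.swap) (simp add: sum_distrib_right[symmetric] col)
  \<comment> \<open>\<open>S3 - q * S1\<close> is the relative entropy of the second marginal with
    respect to the measure with density \<open>f powr q\<close>, whose mass is at most one.\<close>
  have S1_S3: "q * S1 \<le> S3"
  proof -
    have "1 - (\<Sum>y\<in>UNIV. \<nu> y * f y powr q) = (\<Sum>y\<in>UNIV. \<nu> y * \<zeta> y * (1 - f y powr q / \<zeta> y))"
      using zeta by (simp add: right_diff_distrib sum_subtractf zeta1 less_imp_neq[THEN not_sym])
    also have "\<dots> \<le> (\<Sum>y\<in>UNIV. \<nu> y * \<zeta> y * (ln (\<zeta> y) - q * ln (f y)))"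
    proof (intro sum_mono mult_left_mono)
      fix y
      have "1 - inverse (\<zeta> y / f y powr q) \<le> ln (\<zeta> y / f y powr q)"
        using zeta[of y] f[of y] by (intro ln_ge_one_minus_inverse) simp
      then show "1 - f y powr q / \<zeta> y \<le> ln (\<zeta> y) - q * ln (f y)"
        using zeta[of y] f[of y] by (simp add: ln_div ln_powr)
      show "0 \<le> \<nu> y * \<zeta> y" using zeta[of y] nu_pos[of y] by simp
    qed
    also have "\<dots> = S3 - q * S1"
      unfolding S3_def S1_def snd_marginal
      by (simp add: right_diff_distrib sum_subtractf sum_distrib_left mult_ac)
    finally show ?thesis using norm by simp
  qed
  \<comment> \<open>\<open>S1 - S2\<close> is the relative entropy of \<open>R\<close> with respect
    to the coupling that has the same first marginal and moves by \<open>K\<close>; the ratio of the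
    two is \<open>f y / h x\<close>.\<close>
  have S2_S1: "S2 \<le> S1"
  proof -
    have "0 = (\<Sum>x\<in>UNIV. \<Sum>y\<in>UNIV. R x y - \<mu> x * (a x * a x) * K x y)"
      by (simp add: sum_subtractf R1 sum_distrib_left[symmetric] K_sum) (simp add: row[symmetric] R1)
    also have "\<dots> \<le> (\<Sum>x\<in>UNIV. \<Sum>y\<in>UNIV. R x y * (ln (f y) - ln (h x)))"
    proof (intro sum_mono)
      fix x y
      have "h x powr (q * r - 1) * h x = h x powr (q * r)"
        using h[of x] powr_add[of "h x" "q * r - 1" 1] by simp
      then have "R x y * (h x / f y) = \<mu> x * (a x * a x) * K x y"
        using f[of y] by (simp add: R_def aa field_simps)
      then have "R x y - \<mu> x * (a x * a x) * K x y = R x y * (1 - inverse (f y / h x))"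
        by (simp add: right_diff_distrib)
      also have "\<dots> \<le> R x y * ln (f y / h x)"
        using f[of y] h[of x] by (intro mult_left_mono[OF _ R0] ln_ge_one_minus_inverse) simp
      finally show "R x y - \<mu> x * (a x * a x) * K x y \<le> R x y * (ln (f y) - ln (h x))"
        using f[of y] h[of x] by (simp add: ln_div)
    qed
    also have "\<dots> = S1 - S2"
      by (simp add: S1_def S2_def right_diff_distrib sum_subtractf)
    finally show ?thesis by simp
  qed
  define b where "b y = sqrt (\<zeta> y)" for y
  have entropy: "entropy_like (\<lambda>y. (b y)\<^sup>2) \<nu> = S3"
  proof -
    have "(b y)\<^sup>2 = \<zeta> y" for y using zeta[of y] by (simp add: b_def)
    then show ?thesis
      using zeta1 by (simp add: entropy_like_def S3_def snd_marginal mult_ac)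
  qed
  have "1 - wip \<mu> a (act K b)
      \<le> S1 + (q * r / 2 - 1) * S2 - ln Z / 2 - S3 / 2"
  proof -
    have "1 - wip \<mu> a (act K b) = (\<Sum>x\<in>UNIV. \<Sum>y\<in>UNIV. R x y - \<mu> x * K x y * a x * b y)"
      by (simp add: sum_subtractf R1 wip_def act_def sum_distrib_left mult_ac)
    also have "\<dots> \<le> (\<Sum>x\<in>UNIV. \<Sum>y\<in>UNIV. R x y * (ln (f y) + (q * r / 2 - 1) * ln (h x) - ln Z / 2 - ln (\<zeta> y) / 2))"
    proof (intro sum_mono)
      fix x y
      \<comment> \<open>\<open>v\<close> is the ratio of \<open>R x y\<close> to
        \<open>\<mu> x * K x y * a x * b y\<close>, whose total is
        \<open>wip \<mu> a (act K b)\<close>.\<close>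
      define v where "v = f y * h x powr (q * r / 2 - 1) / (sqrt Z * b y)"
      have b: "b y > 0" using zeta[of y] by (simp add: b_def)
      have v: "v > 0" unfolding v_def using f[of y] h[of x] Z b by simp
      have "h x powr (q * r - 1) = h x powr (q * r / 2 - 1) * h x powr (q * r / 2)"
        unfolding powr_add[symmetric] by (rule arg_cong[where f = "\<lambda>c. h x powr c"]) simp
      moreover obtain s where s: "sqrt Z = s" "s > 0" "Z = s * s"
        using Z by (metis real_sqrt_gt_0_iff real_sqrt_mult_self abs_of_pos)
      ultimately have "R x y = \<mu> x * K x y * f y * (h x powr (q * r / 2 - 1) * h x powr (q * r / 2)) / (s * s)"
        unfolding R_def by metis
      then have "R x y * inverse v = \<mu> x * K x y * a x * b y"
        using f[of y] h[of x] s(2) b by (simp add: v_def a_def s(1))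
      then have "R x y - \<mu> x * K x y * a x * b y = R x y * (1 - inverse v)"
        by (simp add: right_diff_distrib)
      also have "\<dots> \<le> R x y * ln v"
        by (intro mult_left_mono[OF _ R0] ln_ge_one_minus_inverse v)
      also have "ln v = ln (f y) + (q * r / 2 - 1) * ln (h x) - ln Z / 2 - ln (\<zeta> y) / 2"
        unfolding v_def using f[of y] h[of x] Z b zeta[of y]
        by (simp add: ln_div ln_mult ln_powr ln_sqrt b_def)
      finally show "R x y - \<mu> x * K x y * a x * b y
        \<le> R x y * (ln (f y) + (q * r / 2 - 1) * ln (h x) - ln Z / 2 - ln (\<zeta> y) / 2)" .
    qed
    also have "\<dots> = S1 + (q * r / 2 - 1) * S2 - (\<Sum>x\<in>UNIV. \<Sum>y\<in>UNIV. R x y) * (ln Z / 2) - S3 / 2"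
      unfolding S1_def S2_def S3_def sum_distrib_left sum_distrib_right sum_divide_distrib
        sum.distrib[symmetric] sum_subtractf[symmetric]
      by (intro sum.cong refl) (simp add: algebra_simps)
    finally show ?thesis by (simp add: R1)
  qed
  \<comment> \<open>Both \<open>a\<close> and \<open>b\<close> have norm one, so this is
    \<open>dirichlet_P\<close> combined with the nonnegative squared norm of
    \<open>a - act K b\<close>.\<close>
  moreover have "dirichlet P \<nu> b \<le> 2 * (1 - wip \<mu> a (act K b))"
  proof -
    have "wip \<nu> b b = 1"
      using zeta zeta1 by (simp add: wip_def b_def mult.assoc less_imp_le)
    moreover have "2 * wip \<mu> a (act K b) \<le> wip \<mu> a a + wip \<mu> (act K b) (act K b)"
    proof -
      have "0 \<le> wip \<mu> (\<lambda>x. a x - act K b x) (\<lambda>x. a x - act K b x)"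
        by (rule wip_nonneg) (rule mu_nonneg)
      then show ?thesis
        by (simp add: wip_diff wip_commute[of \<mu> _ "\<lambda>x. a x - act K b x"] wip_commute[of \<mu> "act K b" a])
    qed
    ultimately show ?thesis by (simp add: dirichlet_P wip_a)
  qed
  moreover have "log_sobolev P \<nu> * S3 \<le> dirichlet P \<nu> b"
    using log_sobolev_P(2)[OF ij, of b] by (simp add: entropy)
  ultimately have main: "r * S3 + ln Z \<le> 2 * S1 + (q * r - 2) * S2"
    by (simp add: r_def algebra_simps add_divide_distrib)
  have r: "r \<ge> 1" using log_sobolev_P(1)[OF ij] by (simp add: r_def)
  \<comment> \<open>Replacing \<open>S3\<close> by \<open>q * S1\<close> makes the coefficients of
    \<open>S1\<close> and \<open>S2\<close> opposite, with \<open>q * r - 2\<close>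
    nonnegative.\<close>
  have "r * (q * S1) \<le> r * S3" using S1_S3 r by (intro mult_left_mono) auto
  with main have "ln Z \<le> (q * r - 2) * (S2 - S1)" by (simp add: algebra_simps)
  also have "\<dots> \<le> 0"
    using S2_S1 mult_mono[of 2 q 1 r] q r by (intro mult_nonneg_nonpos) auto
  finally have "Z \<le> 1" using Z by simp
  then show ?thesis by (simp add: Z_def h_def)
qed

end

section \<open>Composition of the steps\<close>

lemma mu_0: "mu K \<mu>0 0 = \<mu>0"
  by (simp add: mu_def fun_eq_iff if_distrib[of "\<lambda>c. _ * c"] cong: if_cong)

lemma mu_Suc: "mu K \<mu>0 (Suc n) y = (\<Sum>z\<in>UNIV. mu K \<mu>0 n z * K (Suc n) z y)"
proof -
  have "mu K \<mu>0 (Suc n) y = (\<Sum>x\<in>UNIV. \<Sum>z\<in>UNIV. \<mu>0 x * Kprod K n x z * K (Suc n) z y)"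
    by (simp add: mu_def sum_distrib_left mult.assoc)
  also have "\<dots> = (\<Sum>z\<in>UNIV. \<Sum>x\<in>UNIV. \<mu>0 x * Kprod K n x z * K (Suc n) z y)"
    by (rule sum.swap)
  finally show ?thesis by (simp add: mu_def sum_distrib_right)
qed

lemma act_Kprod_Suc: "act (Kprod K (Suc n)) f = act (Kprod K n) (act (K (Suc n)) f)"
proof
  fix x
  have "act (Kprod K (Suc n)) f x = (\<Sum>y\<in>UNIV. \<Sum>z\<in>UNIV. Kprod K n x z * K (Suc n) z y * f y)"
    by (simp add: act_def sum_distrib_right)
  also have "\<dots> = (\<Sum>z\<in>UNIV. \<Sum>y\<in>UNIV. Kprod K n x z * K (Suc n) z y * f y)"
    by (rule sum.swap)
  finally show "act (Kprod K (Suc n)) f x = act (Kprod K n) (act (K (Suc n)) f) x"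
    by (simp add: act_def sum_distrib_left mult.assoc)
qed

locale markov_chain =
  fixes K :: "nat \<Rightarrow> ('v::finite) kernel" and \<mu>0 :: "'v \<Rightarrow> real"
  assumes markov: "\<And>i. i \<ge> 1 \<Longrightarrow> markov_kernel (K i)"
    and prob: "prob_vec \<mu>0"
    and pos: "\<And>k y. mu K \<mu>0 k y > 0"
begin

abbreviation lsob :: "nat \<Rightarrow> real" where
  "lsob i \<equiv> log_sobolev (Pop K \<mu>0 i) (mu K \<mu>0 i)"

lemma mu_sum: "(\<Sum>y\<in>UNIV. mu K \<mu>0 n y) = 1"
proof (induction n)
  case 0
  then show ?case using prob by (simp add: mu_0 prob_vec_def)
next
  case (Suc n)
  have "(\<Sum>y\<in>UNIV. mu K \<mu>0 (Suc n) y) = (\<Sum>z\<in>UNIV. \<Sum>y\<in>UNIV. mu K \<mu>0 n z * K (Suc n) z y)"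
    unfolding mu_Suc by (rule sum.swap)
  also have "\<dots> = 1"
    using markov[of "Suc n"] Suc by (simp add: sum_distrib_left[symmetric] markov_kernel_def)
  finally show ?case .
qed

lemma markov_step: "markov_step (K (Suc n)) (mu K \<mu>0 n) (mu K \<mu>0 (Suc n))"
  using markov[of "Suc n"] pos mu_sum mu_Suc by unfold_locales auto

lemma Pop_Suc: "markov_step.P (K (Suc n)) (mu K \<mu>0 n) (mu K \<mu>0 (Suc n)) = Pop K \<mu>0 (Suc n)"
  by (simp add: markov_step.P_def[OF markov_step] Pop_def)

lemma Kprod_nonneg: "Kprod K n x y \<ge> 0"
proof (induction n arbitrary: y)
  case (Suc n)
  then show ?case
    using markov[of "Suc n"] by (simp add: sum_nonneg markov_kernel_def)
qed simp

lemma Kprod_sum: "(\<Sum>y\<in>UNIV. Kprod K n x y) = 1"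
proof (induction n)
  case (Suc n)
  have "(\<Sum>y\<in>UNIV. Kprod K (Suc n) x y) = act (Kprod K n) (act (K (Suc n)) (\<lambda>_. 1)) x"
    by (simp add: act_Kprod_Suc[symmetric]) (simp add: act_def)
  also have "\<dots> = 1"
    using Suc by (simp add: markov_step.act_K_one[OF markov_step]) (simp add: act_def)
  finally show ?case .
qed simp

text \<open>Index 0 is excluded because \<open>Pop\<close> there involves \<open>K 0\<close>, about
  which nothing is assumed.\<close>

lemma lsob_nonneg: "i \<noteq> (j :: 'v) \<Longrightarrow> k \<ge> 1 \<Longrightarrow> lsob k \<ge> 0"
  using markov_step.log_sobolev_P(1)[OF markov_step[of "k - 1"], unfolded Pop_Suc] by simp

text \<open>The last kernel acts on \<open>f\<close> first. Peeling it off raises the exponent by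
  its factor, so the induction needs arbitrary \<open>q\<close> and \<open>f\<close>.\<close>

lemma hypercontractivity_Kprod:
  assumes ij: "i \<noteq> (j :: 'v)"
    and "q \<ge> 2" "\<And>y. f y > 0" "(\<Sum>y\<in>UNIV. mu K \<mu>0 m y * f y powr q) \<le> 1"
  shows "(\<Sum>x\<in>UNIV. \<mu>0 x * act (Kprod K m) f x powr (q * (\<Prod>i=1..m. 1 + lsob i))) \<le> 1"
  using assms(2-)
proof (induction m arbitrary: q f)
  case 0
  have "act (Kprod K 0) f = f"
    by (simp add: act_def fun_eq_iff if_distrib[of "\<lambda>c. c * _"] cong: if_cong)
  with 0 show ?case by (simp add: mu_0)
next
  case (Suc m)
  interpret S: markov_step "K (Suc m)" "mu K \<mu>0 m" "mu K \<mu>0 (Suc m)" by (rule markov_step)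
  let ?r = "1 + lsob (Suc m)"
  have "?r \<ge> 1" using lsob_nonneg[OF ij, of "Suc m"] by simp
  then have "q * ?r \<ge> 2" using Suc.prems(1) mult_mono[of 2 q 1 ?r] by simp
  moreover have "act (K (Suc m)) f y > 0" for y using Suc.prems(2) by (rule S.act_K_pos)
  moreover have "(\<Sum>y\<in>UNIV. mu K \<mu>0 m y * act (K (Suc m)) f y powr (q * ?r)) \<le> 1"
    using S.hypercontractivity[OF ij, of q f] Suc.prems by (simp add: Pop_Suc)
  ultimately have "(\<Sum>x\<in>UNIV. \<mu>0 x * act (Kprod K m) (act (K (Suc m)) f) x
      powr (q * ?r * (\<Prod>i=1..m. 1 + lsob i))) \<le> 1"
    by (rule Suc.IH)
  then show ?case
    by (simp add: act_Kprod_Suc mult_ac del: Kprod.simps)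
qed

text \<open>A single term of the sum bounded by \<open>hypercontractivity_Kprod\<close> with
  \<open>q = 2\<close> is at most one. Taking logarithms, the weight \<open>\<mu>0 x\<close> costs
  \<open>- ln (\<mu>0 x) / (2 * Q)\<close>, at most 1 by the choice of \<open>m\<close>.\<close>

lemma Kprod_bound:
  assumes ij: "i \<noteq> (j :: 'v)"
    and m: "ln (\<mu>0 x powr (-1/2)) \<le> (\<Prod>i=1..m. 1 + lsob i)"
    and f: "\<And>y. f y > 0" and norm: "wip (mu K \<mu>0 m) f f \<le> 1"
  shows "act (Kprod K m) f x \<le> exp 1"
proof -
  define Q where "Q = (\<Prod>i=1..m. 1 + lsob i)"
  have Q: "Q > 0" unfolding Q_def using lsob_nonneg[OF ij] by (intro prod_pos) (auto intro: add_pos_nonneg)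
  have mu0: "\<mu>0 y > 0" for y using pos[of 0 y] by (simp add: mu_0)
  obtain y where "Kprod K m x y \<noteq> 0"
    using Kprod_sum[of m x] by (metis sum.neutral zero_neq_one)
  then have "0 < Kprod K m x y * f y" using Kprod_nonneg[of m x y] f[of y] by simp
  also have "\<dots> \<le> act (Kprod K m) f x"
    unfolding act_def using f Kprod_nonneg
    by (intro member_le_sum) (auto intro: mult_nonneg_nonneg[OF _ less_imp_le])
  finally have a: "act (Kprod K m) f x > 0" .
  have "\<mu>0 x * act (Kprod K m) f x powr (2 * Q)
      \<le> (\<Sum>x\<in>UNIV. \<mu>0 x * act (Kprod K m) f x powr (2 * Q))"
    by (rule member_le_sum) (auto simp: less_imp_le[OF mu0])
  also have "\<dots> \<le> 1"
    unfolding Q_def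
  proof (rule hypercontractivity_Kprod[OF ij _ f])
    show "(\<Sum>y\<in>UNIV. mu K \<mu>0 m y * f y powr 2) \<le> 1"
      using norm f by (simp add: wip_def power2_eq_square mult.assoc less_imp_le[OF f])
  qed simp
  finally have "ln (\<mu>0 x * act (Kprod K m) f x powr (2 * Q)) \<le> 0"
    using mu0[of x] a by simp
  then have "2 * Q * ln (act (Kprod K m) f x) \<le> - ln (\<mu>0 x)"
    using mu0[of x] a by (simp add: ln_mult ln_powr)
  also have "\<dots> \<le> 2 * Q"
    using m mu0[of x] by (simp add: ln_powr Q_def)
  finally have "ln (act (Kprod K m) f x) \<le> 1" using Q by simp
  then show ?thesis using a by (metis exp_le_cancel_iff exp_ln)
qed

section \<open>Densities relative to the current law and their distance from equilibrium\<close>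

definition dens :: "nat \<Rightarrow> 'v \<Rightarrow> 'v \<Rightarrow> real" where
  "dens n x y = Kprod K n x y / mu K \<mu>0 n y"

lemma dens_nonneg: "dens n x y \<ge> 0"
  unfolding dens_def using Kprod_nonneg pos by (simp add: less_imp_le)

lemma wip_dens: "wip (mu K \<mu>0 n) (dens n x) f = act (Kprod K n) f x"
  using pos by (simp add: wip_def dens_def act_def less_imp_neq[THEN not_sym])

lemma wip_dens_one: "wip (mu K \<mu>0 n) (dens n x) (\<lambda>_. 1) = 1"
  unfolding wip_dens by (simp add: act_def Kprod_sum)

lemma wip_one_one: "wip (mu K \<mu>0 n) (\<lambda>_. 1) (\<lambda>_. 1) = 1"
  by (simp add: wip_def mu_sum)

lemma d2_sq_wip_diff:
  "(d2 (Kprod K n x) (mu K \<mu>0 n))\<^sup>2 = wip (mu K \<mu>0 n) (\<lambda>y. dens n x y - 1) (\<lambda>y. dens n x y - 1)"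
proof -
  have "(\<Sum>y\<in>UNIV. \<bar>Kprod K n x y / mu K \<mu>0 n y - 1\<bar>^2 * mu K \<mu>0 n y) \<ge> 0"
    by (intro sum_nonneg mult_nonneg_nonneg) (auto simp: less_imp_le[OF pos])
  then show ?thesis
    by (simp add: d2_def wip_def dens_def power2_eq_square mult_ac)
qed

text \<open>The variance identity: the density has mean one.\<close>

lemma d2_sq: "(d2 (Kprod K n x) (mu K \<mu>0 n))\<^sup>2 = wip (mu K \<mu>0 n) (dens n x) (dens n x) - 1"
proof -
  let ?w = "wip (mu K \<mu>0 n)" and ?g = "dens n x"
  have "?w ?g (\<lambda>y. ?g y - 1) = ?w ?g ?g - 1"
    unfolding wip_commute[of _ ?g "\<lambda>y. ?g y - 1"] wip_diff
    by (simp only: wip_commute[of _ "\<lambda>_. 1" ?g] wip_dens_one)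
  moreover have "?w (\<lambda>_. 1) (\<lambda>y. ?g y - 1) = 0"
    unfolding wip_commute[of _ "\<lambda>_. 1" "\<lambda>y. ?g y - 1"] wip_diff wip_dens_one wip_one_one by simp
  ultimately show ?thesis unfolding d2_sq_wip_diff wip_diff[of _ ?g "\<lambda>_. 1"] by simp
qed

text \<open>The bound on \<open>K\<^sub>0\<^sub>,\<^sub>m\<close> is available for positive functions only, so it is applied to
  \<open>dens m x + \<epsilon>\<close>, normalised.\<close>
lemma d2_sq_le_exp2:
  assumes ij: "i \<noteq> (j :: 'v)"
    and m: "ln (\<mu>0 x powr (-1/2)) \<le> (\<Prod>i=1..m. 1 + lsob i)"
  shows "(d2 (Kprod K m x) (mu K \<mu>0 m))\<^sup>2 \<le> exp 2"
proof -
  define N where "N = wip (mu K \<mu>0 m) (dens m x) (dens m x)"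
  have N: "N \<ge> 0" unfolding N_def by (rule wip_nonneg) (rule less_imp_le[OF pos])
  have "(N + e)\<^sup>2 \<le> exp 2 * (N + 2 * e + e\<^sup>2)" if e: "e > 0" for e
  proof -
    define g where "g y = dens m x y + e" for y
    \<comment> \<open>The norm of \<open>g\<close>; the cross term is \<open>2 * e\<close> because
      the density has mean one.\<close>
    define c where "c = sqrt (N + 2 * e + e\<^sup>2)"
    have M: "N + 2 * e + e\<^sup>2 > 0" using N e by (simp add: add_nonneg_pos add_pos_pos)
    have c: "c > 0" "c\<^sup>2 = N + 2 * e + e\<^sup>2" using M by (auto simp: c_def)
    have wg: "wip (mu K \<mu>0 m) g f = wip (mu K \<mu>0 m) (dens m x) f + e * wip (mu K \<mu>0 m) (\<lambda>_. 1) f" for f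
      using wip_add[of "mu K \<mu>0 m" "dens m x" "\<lambda>_. e" f] wip_scale[of "mu K \<mu>0 m" e "\<lambda>_. 1" f]
      by (simp add: g_def[abs_def])
    have one: "wip (mu K \<mu>0 m) (\<lambda>_. 1) (dens m x) = 1"
      by (subst wip_commute) (rule wip_dens_one)
    have dg: "wip (mu K \<mu>0 m) (dens m x) g = N + e"
      by (subst wip_commute) (simp add: wg one N_def)
    then have ag: "act (Kprod K m) g x = N + e" by (simp add: wip_dens)
    have "wip (mu K \<mu>0 m) (\<lambda>_. 1) g = 1 + e"
      by (subst wip_commute) (simp add: wg wip_dens_one wip_one_one)
    then have gg: "wip (mu K \<mu>0 m) g g = c\<^sup>2"
      unfolding wg[of g] dg c by (simp add: power2_eq_square algebra_simps)
    have "act (Kprod K m) (\<lambda>y. (1 / c) * g y) x \<le> exp 1"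
    proof (rule Kprod_bound[OF ij m])
      show "0 < (1 / c) * g y" for y
        using c e dens_nonneg[of m x y] by (simp add: g_def add_nonneg_pos)
      show "wip (mu K \<mu>0 m) (\<lambda>y. (1 / c) * g y) (\<lambda>y. (1 / c) * g y) \<le> 1"
        unfolding wip_scale2 gg using c(1) by (simp add: power_one_over)
    qed
    then have "N + e \<le> exp 1 * c" unfolding act_scale ag using c(1) by (simp add: field_simps)
    then have "(N + e)\<^sup>2 \<le> (exp 1 * c)\<^sup>2" using N e by (intro power_mono) auto
    also have "\<dots> = exp 2 * (N + 2 * e + e\<^sup>2)"
      using exp_double[of "1::real"] by (simp add: power_mult_distrib c(2))
    finally show ?thesis .
  qed
  \<comment> \<open>Letting \<open>e\<close> tend to zero gives
    \<open>N * N \<le> exp 2 * N\<close>.\<close>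
  then have "\<forall>\<^sub>F e in at_right 0. (N + e)\<^sup>2 \<le> exp 2 * (N + 2 * e + e\<^sup>2)"
    by (rule eventually_mono[OF eventually_at_right_less])
  moreover have "((\<lambda>e. (N + e)\<^sup>2) \<longlongrightarrow> (N + 0)\<^sup>2) (at_right 0)"
    by (intro tendsto_intros)
  moreover have "((\<lambda>e. exp 2 * (N + 2 * e + e\<^sup>2)) \<longlongrightarrow> exp 2 * (N + 2 * 0 + 0\<^sup>2)) (at_right 0)"
    by (intro tendsto_intros)
  ultimately have "(N + 0)\<^sup>2 \<le> exp 2 * (N + 2 * 0 + 0\<^sup>2)"
    by (intro tendsto_le[of "at_right 0"]) auto
  then have "N * N \<le> exp 2 * N" by (simp add: power2_eq_square)
  then have "N \<le> exp 2" using N by (cases "N = 0") auto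
  then show ?thesis by (simp add: d2_sq N_def)
qed

lemma adj_dens:
  "markov_step.adj (K (Suc n)) (mu K \<mu>0 n) (mu K \<mu>0 (Suc n)) (\<lambda>y. dens n x y - 1) y = dens (Suc n) x y - 1"
proof -
  interpret S: markov_step "K (Suc n)" "mu K \<mu>0 n" "mu K \<mu>0 (Suc n)" by (rule markov_step)
  have "mu K \<mu>0 n z * K (Suc n) z y * (dens n x z - 1) = Kprod K n x z * K (Suc n) z y - mu K \<mu>0 n z * K (Suc n) z y" for z
    using pos[of n z] by (simp add: dens_def field_simps)
  then have "S.adj (\<lambda>y. dens n x y - 1) y = (Kprod K (Suc n) x y - mu K \<mu>0 (Suc n) y) / mu K \<mu>0 (Suc n) y"
    by (simp add: S.adj_def sum_subtractf mu_Suc)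
  also have "\<dots> = dens (Suc n) x y - 1"
    using pos[of "Suc n" y] by (simp add: dens_def diff_divide_distrib)
  finally show ?thesis .
qed

text \<open>This is \<open>adj_contraction\<close> for the centred density, whose image is the next
  centred density by \<open>adj_dens\<close>. Nonnegativity of \<open>second_eig\<close> identifies
  it with the square of \<open>sigma1\<close>.\<close>

lemma d2_sq_Suc:
  assumes ij: "i \<noteq> (j :: 'v)"
  shows "(d2 (Kprod K (Suc n) x) (mu K \<mu>0 (Suc n)))\<^sup>2
    \<le> (sigma1 K \<mu>0 (Suc n))\<^sup>2 * (d2 (Kprod K n x) (mu K \<mu>0 n))\<^sup>2"
proof -
  interpret S: markov_step "K (Suc n)" "mu K \<mu>0 n" "mu K \<mu>0 (Suc n)" by (rule markov_step)
  have "wip (mu K \<mu>0 n) (\<lambda>y. dens n x y - 1) (\<lambda>_. 1) = 0"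
    by (simp add: wip_diff wip_dens_one wip_one_one)
  from S.adj_contraction[OF ij this] S.second_eig_P(1)[OF ij]
  show ?thesis
    by (simp add: d2_sq_wip_diff adj_dens[abs_def] Pop_Suc sigma1_def del: Kprod.simps)
qed

lemma d2_sq_le_prod_sigma1:
  assumes ij: "i \<noteq> (j :: 'v)"
    and m: "ln (\<mu>0 x powr (-1/2)) \<le> (\<Prod>i=1..m. 1 + lsob i)" and "m \<le> n"
  shows "(d2 (Kprod K n x) (mu K \<mu>0 n))\<^sup>2 \<le> exp 2 * (\<Prod>i=m+1..n. (sigma1 K \<mu>0 i)\<^sup>2)"
  using \<open>m \<le> n\<close>
proof (induction n rule: dec_induct)
  case base
  then show ?case using d2_sq_le_exp2[OF ij m] by simp
next
  case (step n)
  have "(d2 (Kprod K (Suc n) x) (mu K \<mu>0 (Suc n)))\<^sup>2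
      \<le> (sigma1 K \<mu>0 (Suc n))\<^sup>2 * (d2 (Kprod K n x) (mu K \<mu>0 n))\<^sup>2"
    by (rule d2_sq_Suc[OF ij])
  also have "\<dots> \<le> (sigma1 K \<mu>0 (Suc n))\<^sup>2 * (exp 2 * (\<Prod>i=m+1..n. (sigma1 K \<mu>0 i)\<^sup>2))"
    using step.IH by (rule mult_left_mono) simp
  also have "\<dots> = exp 2 * (\<Prod>i=m+1..Suc n. (sigma1 K \<mu>0 i)\<^sup>2)"
    using step.hyps by (simp add: prod.nat_ivl_Suc' mult_ac)
  finally show ?case .
qed

text \<open>On a one-point space \<^const>\<open>log_sobolev\<close> is the infimum of the empty set and
  \<^const>\<open>second_eig\<close> reads past the end of its list, so this case is treated separately.\<close>
lemma d2_singleton: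
  assumes "\<And>i j :: 'v. i = j"
  shows "d2 (Kprod K n x) (mu K \<mu>0 n) = 0"
proof -
  have U: "(UNIV :: 'v set) = {x}" using assms by blast
  show ?thesis
    using Kprod_sum[of n x] mu_sum[of n] unfolding U by (simp add: d2_def U)
qed

end

theorem theorem4p5:
  fixes K :: "nat \<Rightarrow> ('v::finite) kernel" and \<mu>0 :: "'v \<Rightarrow> real" and x :: 'v and n :: nat
  assumes markov: "\<And>i. i \<ge> 1 \<Longrightarrow> markov_kernel (K i)"
    and prob: "prob_vec \<mu>0"
    and pos: "\<And>k y. mu K \<mu>0 k y > 0"
    and ex: "\<exists>t::nat. (\<Sum>i=1..t. ln (1 + log_sobolev (Pop K \<mu>0 i) (mu K \<mu>0 i)))
                 \<ge> ln (ln (\<mu>0 x powr (-1/2)))"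
    and n: "n \<ge> (LEAST t::nat. (\<Sum>i=1..t. ln (1 + log_sobolev (Pop K \<mu>0 i) (mu K \<mu>0 i)))
                 \<ge> ln (ln (\<mu>0 x powr (-1/2))))"
  shows "(d2 (Kprod K n x) (mu K \<mu>0 n))^2 \<le>
    exp 2 * (\<Prod>i\<in>{(LEAST t::nat. (\<Sum>i=1..t. ln (1 + log_sobolev (Pop K \<mu>0 i) (mu K \<mu>0 i)))
                 \<ge> ln (ln (\<mu>0 x powr (-1/2)))) + 1..n}. (sigma1 K \<mu>0 i)^2)"
proof -
  interpret markov_chain K \<mu>0 using markov prob pos by unfold_locales
  define m where "m = (LEAST t::nat. (\<Sum>i=1..t. ln (1 + lsob i)) \<ge> ln (ln (\<mu>0 x powr (-1/2))))"
  \<comment> \<open>\<open>LEAST\<close> satisfies its predicate only when some index does, which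
    \<open>ex\<close> provides.\<close>
  have m: "(\<Sum>i=1..m. ln (1 + lsob i)) \<ge> ln (ln (\<mu>0 x powr (-1/2)))"
    unfolding m_def using ex by (rule LeastI_ex)
  have "m \<le> n" using n by (simp add: m_def)
  show ?thesis unfolding m_def[symmetric]
  proof (cases "\<exists>i j :: 'v. i \<noteq> j")
    case True
    then obtain i j :: 'v where ij: "i \<noteq> j" by blast
    have mu0: "\<mu>0 y > 0" for y using pos[of 0 y] by (simp add: mu_0)
    \<comment> \<open>A second point of positive mass gives \<open>\<mu>0 x < 1\<close>, so the
      inner logarithm is positive and the outer one can be cancelled against the logarithm of the
      product.\<close>
    have "\<exists>y. y \<noteq> x" using ij by metis
    then obtain y where "y \<noteq> x" ..
    then have "\<mu>0 x + \<mu>0 y = (\<Sum>z\<in>{x, y}. \<mu>0 z)" by simp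
    also have "\<dots> \<le> (\<Sum>z\<in>UNIV. \<mu>0 z)" by (rule sum_mono2) (auto simp: less_imp_le[OF mu0])
    also have "\<dots> = 1" using prob by (simp add: prob_vec_def)
    finally have "\<mu>0 x < 1" using mu0[of y] by simp
    then have L: "ln (\<mu>0 x powr (-1/2)) > 0" using mu0[of x] by (simp add: ln_powr)
    have factors: "1 + lsob i > 0" if "i \<in> {1..m}" for i
      using lsob_nonneg[OF ij, of i] that by simp
    then have "ln (\<Prod>i=1..m. 1 + lsob i) = (\<Sum>i=1..m. ln (1 + lsob i))"
      by (intro ln_prod) (auto simp: less_imp_neq[THEN not_sym])
    with m have "ln (ln (\<mu>0 x powr (-1/2))) \<le> ln (\<Prod>i=1..m. 1 + lsob i)" by simp
    then have "ln (\<mu>0 x powr (-1/2)) \<le> (\<Prod>i=1..m. 1 + lsob i)"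
      using L factors by (subst (asm) ln_le_cancel_iff) (auto intro: prod_pos)
    then show "(d2 (Kprod K n x) (mu K \<mu>0 n))\<^sup>2 \<le> exp 2 * (\<Prod>i\<in>{m+1..n}. (sigma1 K \<mu>0 i)\<^sup>2)"
      using \<open>m \<le> n\<close> by (rule d2_sq_le_prod_sigma1[OF ij])
  next
    case False
    then have "d2 (Kprod K n x) (mu K \<mu>0 n) = 0" by (intro d2_singleton) blast
    then show "(d2 (Kprod K n x) (mu K \<mu>0 n))\<^sup>2 \<le> exp 2 * (\<Prod>i\<in>{m+1..n}. (sigma1 K \<mu>0 i)\<^sup>2)"
      by (simp add: prod_nonneg)
  qed
qed

end
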